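(* Let $\|\cdot\|$ be a norm on $\mathbb{R}^d$ (the source norm), with associated Capra coupling $c$. Let $F:2^V\to\overline{\mathbb{R}}$ be a set function. Then $$(F\circ\mathrm{supp})^c(y)=\sup_{K\subset V}\Big(\|y_K\|^{\mathcal{R}}_{(K),\star}-F(K)\Big),\qquad\forall y\in\mathbb{R}^d,$$ where $\{\|\cdot\|^{\mathcal{R}}_{(K),\star}\}_{K\subset V}$ is the family of dual local-coordinate-$K$ norms, with the convention $\|y_\emptyset\|^{\mathcal{R}}_{(\emptyset),\star}=0$. If, in addition, the norm $\|\cdot\|$ is orthant-monotonic, then $$(F\circ\mathrm{supp})^c=\sup_{K\subset V}\Big[\|\cdot\|^{\mathrm{tn}}_{\star,(K)}-F(K)\Big],$$ where $\{\|\cdot\|^{\mathrm{tn}}_{\star,(K)}\}_{K\subset V}$ is the family of generalized local-top-$K$ dual norms, with the convention $\|\cdot\|^{\mathrm{tn}}_{\star,(\emptyset)}=0$.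
   Context: $d\ge 1$ is an integer, $V=\{1,\ldots,d\}$, $\langle\cdot,\cdot\rangle$ is the standard scalar product on $\mathbb{R}^d$, $\overline{\mathbb{R}}=[-\infty,+\infty]$. The support mapping is $\mathrm{supp}(x)=\{j\in V: x_j\neq 0\}$. For $K\subset V$, $\mathcal{R}_K=\{x\in\mathbb{R}^d: x_j=0\ \forall j\notin K\}$, and $y_K$ is the orthogonal projection of $y\in\mathbb{R}^d$ on $\mathcal{R}_K$. The dual norm is $\|y\|_\star=\sup_{\|x\|\le 1}\langle x,y\rangle$. A norm $N$ on $\mathbb{R}^d$ is orthant-monotonic if for all $x,x'\in\mathbb{R}^d$: if $|x_i|\le|x'_i|$ and $x_ix'_i\ge 0$ for all $i$, then $N(x)\le N(x')$. For $J\subset V$, $\|\cdot\|_{J,\star}$ is the norm on $\mathcal{R}_J$ dual to the restriction of $\|\cdot\|$ to $\mathcal{R}_J$: $\|y\|_{J,\star}=\sup\{\langle x,y\rangle: x\in\mathcal{R}_J,\ \|x\|\le1\}$, $y\in\mathcal{R}_J$. The dual local-coordinate-$K$ norm is the norm on $\mathcal{R}_K$ given by $\|y\|^{\mathcal{R}}_{(K),\star}=\sup_{J\subset K}\|y_J\|_{J,\star}$. The generalized local-top-$K$ dual norm is the norm on $\mathcal{R}_K$ given by $\|y\|^{\mathrm{tn}}_{\star,(K)}=\sup_{J\subset K}\|y_J\|_\star$, extended to a seminorm on $\mathbb{R}^d$ by $\|y\|^{\mathrm{tn}}_{\star,(K)}=\|y_K\|^{\mathrm{tn}}_{\star,(K)}$.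 The Capra coupling is $c(x,y)=\langle x,y\rangle/\|x\|$ if $x\ne 0$, and $c(0,y)=0$. With the lower addition $\dot{+}_{\mathrm{low}}$ extending $+$ to $\overline{\mathbb{R}}$ by $(+\infty)\dot{+}_{\mathrm{low}}(-\infty)=(-\infty)\dot{+}_{\mathrm{low}}(+\infty)=-\infty$, the $c$-conjugate of $f:\mathbb{R}^d\to\overline{\mathbb{R}}$ is $f^c(y)=\sup_{x\in\mathbb{R}^d}\big(c(x,y)\dot{+}_{\mathrm{low}}(-f(x))\big)$. *)

theory Defs
  imports "HOL-Analysis.Analysis"
begin

(* Vectors of R^d are elements of real ^ 'n: the finite index type 'n plays the role of
   V = {1, ..., d}, with d = CARD('n) >= 1. *)

definition is_norm :: "(real ^ 'n \<Rightarrow> real) \<Rightarrow> bool" where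
  "is_norm N \<longleftrightarrow>
     (\<forall>x. 0 \<le> N x) \<and>
     (\<forall>x. N x = 0 \<longleftrightarrow> x = 0) \<and>
     (\<forall>a x. N (a *\<^sub>R x) = \<bar>a\<bar> * N x) \<and>
     (\<forall>x y. N (x + y) \<le> N x + N y)"

definition orthant_monotonic :: "(real ^ 'n \<Rightarrow> real) \<Rightarrow> bool" where
  "orthant_monotonic N \<longleftrightarrow>
     (\<forall>x x'. (\<forall>i. \<bar>x $ i\<bar> \<le> \<bar>x' $ i\<bar> \<and> x $ i * x' $ i \<ge> 0) \<longrightarrow> N x \<le> N x')"

definition supp :: "real ^ 'n \<Rightarrow> 'n set" where
  "supp x = {j. x $ j \<noteq> 0}"

definition coord_subspace :: "'n set \<Rightarrow> (real ^ 'n) set" where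
  "coord_subspace K = {x. \<forall>j. j \<notin> K \<longrightarrow> x $ j = 0}"

(* On a subspace, the Euclidean closest point is the orthogonal projection; see
   coord_proj_nth and coord_proj_orthogonal below. *)
definition coord_proj :: "'n set \<Rightarrow> real ^ 'n \<Rightarrow> real ^ 'n" where
  "coord_proj K y = closest_point (coord_subspace K) y"

(* The suprema in the next four definitions are taken in the reals. They are suprema of
   nonempty bounded sets when N is a norm; see bdd_above_dual_norm and
   bdd_above_local_dual_norm below (the sets indexed by Pow K are finite). *)
definition dual_norm :: "(real ^ 'n \<Rightarrow> real) \<Rightarrow> real ^ 'n \<Rightarrow> real" where
  "dual_norm N y = Sup {x \<bullet> y | x. N x \<le> 1}"

(* Meant as a norm on coord_subspace J only. *)
definition local_dual_norm :: "(real ^ 'n \<Rightarrow> real) \<Rightarrow> 'n set \<Rightarrow> real ^ 'n \<Rightarrow> real" where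
  "local_dual_norm N J y = Sup {x \<bullet> y | x. x \<in> coord_subspace J \<and> N x \<le> 1}"

(* Meant as a norm on coord_subspace K only. *)
definition dual_local_coord_norm :: "(real ^ 'n \<Rightarrow> real) \<Rightarrow> 'n set \<Rightarrow> real ^ 'n \<Rightarrow> real" where
  "dual_local_coord_norm N K y = (SUP J\<in>Pow K. local_dual_norm N J (coord_proj J y))"

(* Meant as a norm on coord_subspace K only. *)
definition local_top_dual_norm :: "(real ^ 'n \<Rightarrow> real) \<Rightarrow> 'n set \<Rightarrow> real ^ 'n \<Rightarrow> real" where
  "local_top_dual_norm N K y = (SUP J\<in>Pow K. dual_norm N (coord_proj J y))"

(* Extension of the previous norm to a seminorm on the whole space. *)
definition local_top_dual_seminorm :: "(real ^ 'n \<Rightarrow> real) \<Rightarrow> 'n set \<Rightarrow> real ^ 'n \<Rightarrow> real" where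
  "local_top_dual_seminorm N K y = local_top_dual_norm N K (coord_proj K y)"

definition capra :: "(real ^ 'n \<Rightarrow> real) \<Rightarrow> real ^ 'n \<Rightarrow> real ^ 'n \<Rightarrow> real" where
  "capra N x y = (if x = 0 then 0 else (x \<bullet> y) / N x)"

(* The addition of type ereal has \<infinity> + -\<infinity> = \<infinity>, hence the separate definition. *)
definition low_add :: "ereal \<Rightarrow> ereal \<Rightarrow> ereal" where
  "low_add a b = (if a = -\<infinity> \<or> b = -\<infinity> then -\<infinity> else a + b)"

definition conjugate :: "('a \<Rightarrow> 'b \<Rightarrow> real) \<Rightarrow> ('a \<Rightarrow> ereal) \<Rightarrow> 'b \<Rightarrow> ereal" where
  "conjugate c f y = (SUP x. low_add (ereal (c x y)) (- f x))"

lemma coord_proj_nth: "coord_proj K y $ j = (if j \<in> K then y $ j else 0)"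
proof -
  let ?S = "coord_subspace K" and ?z = "(\<chi> j. if j \<in> K then y $ j else 0)"
  have sub: "subspace ?S"
    by (auto simp: subspace_def coord_subspace_def)
  have "?z = closest_point ?S y"
  proof (rule closest_point_unique)
    show "convex ?S" "closed ?S"
      using sub by (auto simp: subspace_imp_convex closed_subspace)
    show "?z \<in> ?S" by (simp add: coord_subspace_def)
    show "\<forall>w\<in>?S. dist y ?z \<le> dist y w"
    proof
      fix w assume w: "w \<in> ?S"
      have "norm (y - ?z) \<le> norm (y - w)"
        by (rule norm_le_componentwise_cart) (use w in \<open>auto simp: coord_subspace_def\<close>)
      then show "dist y ?z \<le> dist y w" by (simp add: dist_norm)
    qed
  qed
  then show ?thesis by (simp add: coord_proj_def flip: \<open>?z = closest_point ?S y\<close>)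
qed

lemma coord_proj_orthogonal:
  "coord_proj K y \<in> coord_subspace K"
  "x \<in> coord_subspace K \<Longrightarrow> (y - coord_proj K y) \<bullet> x = 0"
  by (auto simp: coord_subspace_def coord_proj_nth inner_vec_def intro!: sum.neutral)

lemma is_norm_bounded_unit_ball:
  fixes N :: "real ^ 'n \<Rightarrow> real"
  assumes N: "is_norm N"
  shows "bounded {x. N x \<le> 1}"
proof -
  have pos: "0 \<le> N x" and zero: "N x = 0 \<longleftrightarrow> x = 0" and scale: "N (a *\<^sub>R x) = \<bar>a\<bar> * N x"
    and tri: "N (x + y) \<le> N x + N y" for a x y
    using N by (auto simp: is_norm_def)
  have neg: "N (- x) = N x" for x using scale[of "-1" x] by simp
  have cvx: "convex_on UNIV N"
  proof (rule convex_onI)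
    fix t :: real and x y :: "real ^ 'n"
    assume "0 < t" "t < 1"
    then show "N ((1 - t) *\<^sub>R x + t *\<^sub>R y) \<le> (1 - t) * N x + t * N y"
      using tri[of "(1 - t) *\<^sub>R x" "t *\<^sub>R y"] by (simp add: scale)
  qed simp
  have cont: "continuous_on UNIV N"
    by (rule convex_on_continuous) (use cvx in auto)
  have ne: "sphere (0 :: real ^ 'n) 1 \<noteq> {}" by simp
  obtain u where u: "u \<in> sphere 0 1" and le: "\<And>v. v \<in> sphere 0 1 \<Longrightarrow> N u \<le> N v"
    using continuous_attains_inf[OF compact_sphere ne continuous_on_subset[OF cont]] by auto
  have upos: "0 < N u" using u pos[of u] zero[of u] by (auto simp: less_le)
  have "norm x \<le> 1 / N u" if "N x \<le> 1" for x
  proof (cases "x = 0")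
    case False
    then have "N u \<le> N ((1 / norm x) *\<^sub>R x)" by (intro le) simp
    then have "N u * norm x \<le> N x" using False by (simp add: scale field_simps)
    then show ?thesis using that upos by (simp add: field_simps)
  qed (use upos in simp)
  then show ?thesis by (auto simp: bounded_iff)
qed

lemma bdd_above_dual_norm:
  assumes "is_norm N"
  shows "bdd_above {x \<bullet> y | x. N x \<le> 1}"
proof -
  obtain B where B: "\<And>x. N x \<le> 1 \<Longrightarrow> norm x \<le> B"
    using is_norm_bounded_unit_ball[OF assms] by (auto simp: bounded_iff)
  have "x \<bullet> y \<le> B * norm y" if "N x \<le> 1" for x
    using norm_cauchy_schwarz[of x y] mult_right_mono[OF B[OF that] norm_ge_zero[of y]]
    by linarith
  then show ?thesis by (auto simp: bdd_above_def)
qed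

lemma bdd_above_local_dual_norm:
  assumes "is_norm N"
  shows "bdd_above {x \<bullet> y | x. x \<in> coord_subspace J \<and> N x \<le> 1}"
  by (rule bdd_above_mono[OF bdd_above_dual_norm[OF assms]]) auto

(* The conventions for the empty index set are consequences of the definitions. *)
lemma empty_index_conventions:
  assumes "is_norm N"
  shows "dual_local_coord_norm N {} y = 0" "local_top_dual_seminorm N {} y = 0"
proof -
  have N0: "N 0 = 0" using assms by (simp add: is_norm_def)
  have p: "coord_proj {} z = 0" for z by (simp add: vec_eq_iff coord_proj_nth)
  have "{x \<bullet> (0 :: real ^ 'a) | x. x \<in> coord_subspace {} \<and> N x \<le> 1} = {0}"
    using N0 by (auto simp: coord_subspace_def intro!: exI[of _ 0])
  then show "dual_local_coord_norm N {} y = 0"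
    by (simp add: dual_local_coord_norm_def local_dual_norm_def p)
  have "{x \<bullet> (0 :: real ^ 'a) | x. N x \<le> 1} = {0}"
    using N0 by (auto intro!: exI[of _ 0])
  then show "local_top_dual_seminorm N {} y = 0"
    by (simp add: local_top_dual_seminorm_def local_top_dual_norm_def dual_norm_def p)
qed

end

theory Submission
  imports Defs
begin

text \<open>
  The function \<open>F \<circ> supp\<close> is constant on each level set \<open>{x. supp x = K}\<close>, so the supremum
  defining its conjugate splits into an inner supremum of the coupling over the \<open>x\<close> with support
  exactly \<open>K\<close> and an outer one over \<open>K\<close> of the result diminished by \<open>F K\<close>.

  The inner supremum is the dual norm of \<open>y\<^sub>K\<close> relative to the subspace \<open>\<R>\<^sub>K\<close>, because the
  vectors of support exactly \<open>K\<close> are dense in \<open>\<R>\<^sub>K\<close>; this is the only analytic ingredient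
  (\<open>inner_le_of_capra_le_on_support\<close>, \<open>SUP_capra_support\<close>). The local dual norms
  grow with the index set, hence the supremum over \<open>J \<subseteq> K\<close> in the dual local-coordinate norm is
  attained at \<open>J = K\<close> and it equals that inner supremum (\<open>dual_local_coord_norm_eq\<close>).

  For an orthant-monotonic norm, projecting on \<open>\<R>\<^sub>J\<close> does not increase the norm. Therefore a
  vector supported in \<open>J\<close> has the same dual norm whether it is tested against all of the unit ball
  or only against the part of the ball in \<open>\<R>\<^sub>J\<close>, and the two families of norms coincide.
\<close>

lemma inner_coord_proj:
  assumes "x \<in> coord_subspace J"
  shows "x \<bullet> coord_proj J y = x \<bullet> y"
  using coord_proj_orthogonal(2)[OF assms, of y] by (simp add: inner_commute[of x] inner_diff_left)

lemma coord_proj_inner_swap: "x \<bullet> coord_proj J y = coord_proj J x \<bullet> y"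
  by (auto simp: inner_vec_def coord_proj_nth intro!: sum.cong)

lemma supp_indicator: "supp (\<chi> j. if j \<in> K then 1 else 0) = K"
  by (auto simp: supp_def)

lemma coord_proj_absorb:
  assumes "J \<subseteq> K"
  shows "coord_proj J (coord_proj K y) = coord_proj J y"
  using assms by (auto simp: vec_eq_iff coord_proj_nth)

lemma local_dual_norm_coord_proj:
  "local_dual_norm N J (coord_proj J y) = Sup {x \<bullet> y | x. x \<in> coord_subspace J \<and> N x \<le> 1}"
  unfolding local_dual_norm_def
  by (rule arg_cong[where f = Sup], rule Collect_cong) (metis inner_coord_proj)

lemma local_unit_ball_inner_nonempty:
  assumes "is_norm N"
  shows "{x \<bullet> y |x. x \<in> coord_subspace J \<and> N x \<le> 1} \<noteq> {}"
proof -
  have "N 0 = 0"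
    using assms by (simp add: is_norm_def)
  then have "N 0 \<le> 1" by simp
  moreover have "0 \<in> coord_subspace J"
    by (simp add: coord_subspace_def)
  ultimately show ?thesis by blast
qed

lemma local_dual_norm_mono:
  assumes "is_norm N" and "J \<subseteq> K"
  shows "local_dual_norm N J (coord_proj J y) \<le> local_dual_norm N K (coord_proj K y)"
  unfolding local_dual_norm_coord_proj
proof (rule cSup_subset_mono)
  show "{x \<bullet> y |x. x \<in> coord_subspace J \<and> N x \<le> 1} \<noteq> {}"
    by (rule local_unit_ball_inner_nonempty[OF assms(1)])
  show "{x \<bullet> y |x. x \<in> coord_subspace J \<and> N x \<le> 1}
      \<subseteq> {x \<bullet> y |x. x \<in> coord_subspace K \<and> N x \<le> 1}"
    using assms(2) by (auto simp: coord_subspace_def)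
qed (rule bdd_above_local_dual_norm[OF assms(1)])

lemma dual_local_coord_norm_eq:
  assumes "is_norm N"
  shows "dual_local_coord_norm N K (coord_proj K y) = local_dual_norm N K (coord_proj K y)"
  unfolding dual_local_coord_norm_def
proof (rule cSup_eq_maximum)
  show "local_dual_norm N K (coord_proj K y)
      \<in> (\<lambda>J. local_dual_norm N J (coord_proj J (coord_proj K y))) ` Pow K"
    by (rule image_eqI[of _ _ K]) (simp_all add: coord_proj_absorb)
qed (auto simp: coord_proj_absorb intro: local_dual_norm_mono[OF assms])

text \<open>
  An upper bound for the coupling on vectors of full support in \<open>K\<close> passes to all of \<open>\<R>\<^sub>K\<close>:
  adding a small positive multiple of the indicator vector of \<open>K\<close> to \<open>x \<in> \<R>\<^sub>K\<close> makes all
  coordinates in \<open>K\<close> nonzero, and the resulting error vanishes in the limit.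
\<close>

lemma inner_le_of_capra_le_on_support:
  fixes N :: "real ^ 'n \<Rightarrow> real"
  assumes N: "is_norm N"
    and bound: "\<And>z. supp z = K \<Longrightarrow> capra N z y \<le> M"
    and x: "x \<in> coord_subspace K"
  shows "x \<bullet> y \<le> M * N x" and "0 \<le> M"
proof -
  have pos: "0 \<le> N z" and zero: "N z = 0 \<longleftrightarrow> z = 0" and scale: "N (a *\<^sub>R z) = \<bar>a\<bar> * N z"
    and tri: "N (z + w) \<le> N z + N w" for a z w
    using N by (auto simp: is_norm_def)
  define e :: "real ^ 'n" where "e = (\<chi> j. if j \<in> K then 1 else 0)"
  have neg: "N (- z) = N z" for z using scale[of "-1" z] by simp
  \<comment> \<open>The coupling is odd in its first argument, so it takes a nonnegative value at \<open>e\<close> or \<open>- e\<close>.\<close>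
  have "supp e = K" "supp (- e) = K"
    by (auto simp: supp_def e_def)
  then have "capra N e y \<le> M" "capra N (- e) y \<le> M"
    by (auto intro: bound)
  moreover have "capra N (- e) y = - capra N e y"
    by (simp add: capra_def neg)
  ultimately show M: "0 \<le> M" by linarith
  have inner_le: "z \<bullet> y \<le> M * N z" if "supp z = K" for z
  proof (cases "z = 0")
    case False
    then have "0 < N z" using pos[of z] zero[of z] by (simp add: less_le)
    then show ?thesis using bound[OF that] False by (simp add: capra_def divide_le_eq)
  qed (use zero[of 0] in simp)
  have nz: "\<forall>\<^sub>F t in at_right 0. x $ j + t \<noteq> 0" for j
  proof (cases "x $ j < 0")
    case True
    then show ?thesis
      using eventually_at_right_less eventually_at_right_real[of 0 "- x $ j"]
      by (auto elim!: eventually_mono)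
  next
    case False
    then show ?thesis
      by (intro eventually_mono[OF eventually_at_right_less]) auto
  qed
  have "\<forall>\<^sub>F t in at_right 0. \<forall>j. x $ j + t \<noteq> 0"
    by (rule eventually_all_finite) (rule nz)
  then have full: "\<forall>\<^sub>F t in at_right 0. supp (x + t *\<^sub>R e) = K"
    by (rule eventually_mono) (use x in \<open>auto simp: supp_def e_def coord_subspace_def\<close>)
  have "\<forall>\<^sub>F t in at_right 0. (x + t *\<^sub>R e) \<bullet> y - t * (M * N e) \<le> M * N x"
    using full eventually_at_right_less[of 0]
  proof eventually_elim
    case (elim t)
    have "(x + t *\<^sub>R e) \<bullet> y \<le> M * N (x + t *\<^sub>R e)" by (rule inner_le) (rule elim)
    also have "\<dots> \<le> M * (N x + t * N e)"
      using tri[of x "t *\<^sub>R e"] elim M by (intro mult_left_mono) (auto simp: scale)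
    finally show ?case by (simp add: algebra_simps)
  qed
  moreover have "((\<lambda>t. (x + t *\<^sub>R e) \<bullet> y - t * (M * N e)) \<longlongrightarrow> (x + 0 *\<^sub>R e) \<bullet> y - 0 * (M * N e))
      (at_right 0)"
    by (intro tendsto_intros)
  ultimately show "x \<bullet> y \<le> M * N x"
    using tendsto_upperbound[of _ "(x + 0 *\<^sub>R e) \<bullet> y - 0 * (M * N e)" "at_right (0::real)"]
    by simp
qed

lemma capra_le_local_dual_norm:
  assumes N: "is_norm N" and x: "x \<in> coord_subspace K"
  shows "capra N x y \<le> local_dual_norm N K (coord_proj K y)"
proof -
  let ?u = "(1 / N x) *\<^sub>R x"
  have scale: "N ?u = \<bar>1 / N x\<bar> * N x" and N0: "0 \<le> N x"
    using N by (simp_all add: is_norm_def)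
  \<comment> \<open>For \<open>x = 0\<close> division by zero gives \<open>?u = 0\<close>, so the identity below holds there too.\<close>
  have "capra N x y = ?u \<bullet> y"
    by (simp add: capra_def)
  moreover have "N ?u \<le> 1"
    using scale N0 by (cases "N x = 0") simp_all
  moreover have "?u \<in> coord_subspace K"
    using x by (simp add: coord_subspace_def)
  ultimately show ?thesis
    unfolding local_dual_norm_coord_proj
    by (intro cSup_upper bdd_above_local_dual_norm[OF N]) blast
qed

text \<open>
  The right-hand side also counts vectors whose support is a proper subset of \<open>K\<close>; they do not
  raise the supremum, by the perturbation argument above.
\<close>

lemma SUP_capra_support:
  fixes N :: "real ^ 'n \<Rightarrow> real"
  assumes N: "is_norm N"
  shows "(SUP x\<in>{x. supp x = K}. ereal (capra N x y)) = ereal (local_dual_norm N K (coord_proj K y))"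
proof (rule SUP_eqI)
  fix x :: "real ^ 'n" assume "x \<in> {x. supp x = K}"
  then have "x \<in> coord_subspace K" by (auto simp: supp_def coord_subspace_def)
  then show "ereal (capra N x y) \<le> ereal (local_dual_norm N K (coord_proj K y))"
    by (simp add: capra_le_local_dual_norm[OF N])
next
  fix b :: ereal
  assume b: "\<And>x. x \<in> {x. supp x = K} \<Longrightarrow> ereal (capra N x y) \<le> b"
  show "ereal (local_dual_norm N K (coord_proj K y)) \<le> b"
  proof (cases b)
    case (real M)
    have bound: "capra N z y \<le> M" if "supp z = K" for z
      using b[of z] that real by simp
    have "z \<bullet> y \<le> M" if z: "z \<in> coord_subspace K" "N z \<le> 1" for z
      using inner_le_of_capra_le_on_support[OF N bound z(1)] z(2) mult_left_mono[of "N z" 1 M]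
      by auto
    then have "local_dual_norm N K (coord_proj K y) \<le> M"
      unfolding local_dual_norm_coord_proj by (intro cSup_least local_unit_ball_inner_nonempty[OF N]) auto
    then show ?thesis by (simp add: real)
  next
    case MInf
    then show ?thesis using b[of "\<chi> j. if j \<in> K then 1 else 0"] by (simp add: supp_indicator)
  qed simp
qed

text \<open>
  The coupling is finite, so the lower addition agrees with the subtraction of extended reals, and
  the vectors can be grouped by support. The case \<open>F K = \<infinity>\<close> is separate because a supremum
  need not commute with adding \<open>-\<infinity>\<close>: finite values can have supremum \<open>\<infinity>\<close>, and
  \<open>\<infinity> + -\<infinity> = \<infinity>\<close> for extended reals.
\<close>

lemma conjugate_capra_supp:
  fixes N :: "real ^ 'n \<Rightarrow> real"
  assumes N: "is_norm N"
  shows "conjugate (capra N) (F \<circ> supp) y =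
    (SUP K. ereal (local_dual_norm N K (coord_proj K y)) - F K)"
proof -
  have low: "low_add (ereal a) (- b) = ereal a - b" for a b
    by (cases b) (auto simp: low_add_def)
  have level: "(SUP x\<in>{x. supp x = K}. ereal (capra N x y) - F K)
      = ereal (local_dual_norm N K (coord_proj K y)) - F K" for K
  proof -
    have ne: "{x :: real ^ 'n. supp x = K} \<noteq> {}"
      using supp_indicator[of K] by blast
    show ?thesis
    proof (cases "F K = \<infinity>")
      case True
      then show ?thesis using ne by simp
    next
      case False
      then have "- F K \<noteq> -\<infinity>" by simp
      then show ?thesis
        using SUP_ereal_add_left[OF ne, of "- F K" "\<lambda>x. ereal (capra N x y)"]
        by (simp add: minus_ereal_def SUP_capra_support[OF N])
    qed
  qed
  have "(SUP x. ereal (capra N x y) - F (supp x))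
      = (SUP K. SUP x\<in>{x. supp x = K}. ereal (capra N x y) - F K)"
  proof (rule antisym)
    show "(SUP x. ereal (capra N x y) - F (supp x))
        \<le> (SUP K. SUP x\<in>{x. supp x = K}. ereal (capra N x y) - F K)"
    proof (rule SUP_least)
      fix x
      show "ereal (capra N x y) - F (supp x)
          \<le> (SUP K. SUP x\<in>{x. supp x = K}. ereal (capra N x y) - F K)"
        by (rule SUP_upper2[of "supp x"], simp, rule SUP_upper) simp
    qed
    show "(SUP K. SUP x\<in>{x. supp x = K}. ereal (capra N x y) - F K)
        \<le> (SUP x. ereal (capra N x y) - F (supp x))"
      by (intro SUP_least) (auto intro: SUP_upper)
  qed
  then show ?thesis
    by (simp add: conjugate_def low level)
qed

text \<open>
  By orthant monotonicity the unit ball projects into its own intersection with \<open>\<R>\<^sub>J\<close>, and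
  replacing a test vector by its projection does not change its product with a vector of \<open>\<R>\<^sub>J\<close>.
\<close>

lemma dual_norm_coord_proj_orthant_monotonic:
  assumes om: "orthant_monotonic N"
  shows "dual_norm N (coord_proj J y) = local_dual_norm N J (coord_proj J y)"
proof -
  have proj: "N (coord_proj J x) \<le> N x" for x
    using om by (auto simp: orthant_monotonic_def coord_proj_nth)
  have "{x \<bullet> coord_proj J y |x. N x \<le> 1}
      = {x \<bullet> y |x. x \<in> coord_subspace J \<and> N x \<le> 1}"
  proof (intro equalityI subsetI)
    fix r assume "r \<in> {x \<bullet> coord_proj J y |x. N x \<le> 1}"
    then obtain x where "N x \<le> 1" "r = coord_proj J x \<bullet> y"
      by (auto simp: coord_proj_inner_swap)
    then show "r \<in> {x \<bullet> y |x. x \<in> coord_subspace J \<and> N x \<le> 1}"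
      using proj[of x] coord_proj_orthogonal(1)[of J x] by fastforce
  next
    fix r assume "r \<in> {x \<bullet> y |x. x \<in> coord_subspace J \<and> N x \<le> 1}"
    then obtain x where x: "x \<in> coord_subspace J" "N x \<le> 1" "r = x \<bullet> y"
      by blast
    then have "r = x \<bullet> coord_proj J y"
      by (simp add: inner_coord_proj)
    with x(2) show "r \<in> {x \<bullet> coord_proj J y |x. N x \<le> 1}" by blast
  qed
  then show ?thesis
    by (simp add: dual_norm_def local_dual_norm_coord_proj)
qed

lemma local_top_dual_seminorm_eq_dual_local_coord_norm:
  assumes "orthant_monotonic N"
  shows "local_top_dual_seminorm N K y = dual_local_coord_norm N K (coord_proj K y)"
  unfolding local_top_dual_seminorm_def local_top_dual_norm_def dual_local_coord_norm_def
  by (simp add: dual_norm_coord_proj_orthant_monotonic[OF assms])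

theorem proposition10:
  fixes N :: "real ^ 'n \<Rightarrow> real" and F :: "'n set \<Rightarrow> ereal"
  assumes "is_norm N"
  shows "(\<forall>y. conjugate (capra N) (F \<circ> supp) y =
              (SUP K. ereal (dual_local_coord_norm N K (coord_proj K y)) - F K)) \<and>
         (orthant_monotonic N \<longrightarrow>
            conjugate (capra N) (F \<circ> supp) =
              (\<lambda>y. SUP K. ereal (local_top_dual_seminorm N K y) - F K))"
  by (auto simp: conjugate_capra_supp[OF assms] dual_local_coord_norm_eq[OF assms]
      local_top_dual_seminorm_eq_dual_local_coord_norm)

end
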